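(* Let $X$ be a real vector space ordered by a cone $K$, and let $d$ be the Thompson metric on $K$. 1. The function $d$ is quasi-convex with respect to each of its arguments, that is, $$d((1-t)x+ty,v)\le\max\{d(x,v),d(y,v)\}\quad\text{and}\quad d(u,(1-t)x+ty)\le\max\{d(u,x),d(u,y)\},$$ for all $x,y,u,v\in K$ and $t\in[0,1]$. 2. The following convexity-type inequalities hold: $$d((1-t)x+ty,v)\le\ln\left((1-t)e^{d(x,v)}+te^{d(y,v)}\right),\qquad d(u,(1-t)x+ty)\le\ln\left((1-t)e^{d(u,x)}+te^{d(u,y)}\right),$$ for all $x,y,u,v\in K$ and $t\in[0,1]$, and $$d((1-t)x+ty,(1-s)x+sy)\le\ln\left(|s-t|e^{d(x,y)}+1-|s-t|\right),$$ for all $x,y\in K$ with $x\sim y$ and all $s,t\in[0,1]$.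
   Context: A cone $K$ in a real vector space $X$ is a nonempty subset with $K+K\subset K$, $tK\subset K$ for all $t\ge 0$, and $K\cap(-K)=\{0\}$; it induces the order $x\le y\iff y-x\in K$. Two elements $x,y\in K$ are linked, written $x\sim y$, if there are $\lambda,\mu>0$ with $x\le\lambda y$ and $y\le\mu x$. The Thompson metric is $d(x,y)=\inf\{s\ge 0: e^{-s}x\le y\le e^{s}x\}\in[0,\infty]$ for $x,y\in K$, with $\inf\emptyset=\infty$; thus $d(x,y)<\infty$ iff $x\sim y$. Usual conventions: $e^{\infty}=\infty$, $\ln\infty=\infty$, $0\cdot\infty=0$. *)

theory Defs
  imports "HOL-Analysis.Convex" "HOL-Library.Extended_Real"
begin

definition order_cone :: "'a::real_vector set \<Rightarrow> bool" where
  "order_cone K \<longleftrightarrow>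
     K \<noteq> {} \<and> (\<forall>x\<in>K. \<forall>y\<in>K. x + y \<in> K) \<and> cone K \<and> K \<inter> uminus ` K = {0}"

definition cone_le :: "'a::real_vector set \<Rightarrow> 'a \<Rightarrow> 'a \<Rightarrow> bool" where
  "cone_le K x y \<longleftrightarrow> y - x \<in> K"

definition linked :: "'a::real_vector set \<Rightarrow> 'a \<Rightarrow> 'a \<Rightarrow> bool" where
  "linked K x y \<longleftrightarrow>
     (\<exists>l>0. \<exists>m>0. cone_le K x (l *\<^sub>R y) \<and> cone_le K y (m *\<^sub>R x))"

text \<open>The infimum is taken in \<^typ>\<open>ereal\<close>, so that the infimum of the empty set is
  \<open>\<infinity>\<close>. Like \<open>linked\<close>, the metric is only meant for arguments in the cone.\<close>

definition thompson :: "'a::real_vector set \<Rightarrow> 'a \<Rightarrow> 'a \<Rightarrow> ereal" where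
  "thompson K x y =
     Inf {ereal s | s. 0 \<le> s \<and> cone_le K (exp (- s) *\<^sub>R x) y \<and> cone_le K y (exp s *\<^sub>R x)}"

definition exp_ereal :: "ereal \<Rightarrow> ereal" where
  "exp_ereal x = (case x of ereal r \<Rightarrow> ereal (exp r) | PInfty \<Rightarrow> \<infinity> | MInfty \<Rightarrow> 0)"

text \<open>Following the limit at \<open>0\<close>, nonpositive arguments get the value \<open>-\<infinity>\<close>
  (in particular not the library value \<open>ln 0 = 0\<close>).\<close>

definition ln_ereal :: "ereal \<Rightarrow> ereal" where
  "ln_ereal x =
     (case x of ereal r \<Rightarrow> (if 0 < r then ereal (ln r) else - \<infinity>) | PInfty \<Rightarrow> \<infinity> | MInfty \<Rightarrow> - \<infinity>)"

end

theory Submission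
  imports Defs
begin

text \<open>The constants of the two-sided bounds \<open>x \<le> c y\<close>, \<open>y \<le> c x\<close> behave well under
  convex combinations: if \<open>a\<close> works for \<open>(x, v)\<close> and \<open>b\<close> for \<open>(y, v)\<close>, then
  \<open>(1 - t) a + t b\<close> works for \<open>((1 - t) x + t y, v)\<close>, the lower bound being the convexity of
  \<open>c \<mapsto> 1 / c\<close>. For two points of a segment the constant \<open>|s - t| a + 1 - |s - t|\<close> comes from
  \<open>a + 1 / a \<ge> 2\<close>. Both expressions grow at most by the factor \<open>e\<^sup>\<epsilon>\<close> when \<open>a\<close> and
  \<open>b\<close> do, which passes from admissible constants to the infimum; the cone need not be
  Archimedean, so the infimum need not be attained.\<close>

text \<open>With \<open>c = exp s\<close> this is the condition under the infimum in
  \<open>thompson\<close>, the lower bound multiplied through by \<open>c\<close>. In this form the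
  symmetry in \<open>x\<close> and \<open>y\<close> is visible and no inverses occur.\<close>

definition mutual_bound :: "'a::real_vector set \<Rightarrow> real \<Rightarrow> 'a \<Rightarrow> 'a \<Rightarrow> bool" where
  "mutual_bound K c x y \<longleftrightarrow> cone_le K x (c *\<^sub>R y) \<and> cone_le K y (c *\<^sub>R x)"

lemma mutual_bound_commute: "mutual_bound K c x y \<longleftrightarrow> mutual_bound K c y x"
  by (auto simp: mutual_bound_def)

section \<open>Arithmetic of the cone order\<close>

lemma order_cone_add: "order_cone K \<Longrightarrow> x \<in> K \<Longrightarrow> y \<in> K \<Longrightarrow> x + y \<in> K"
  by (simp add: order_cone_def)

lemma order_cone_scale: "order_cone K \<Longrightarrow> x \<in> K \<Longrightarrow> 0 \<le> c \<Longrightarrow> c *\<^sub>R x \<in> K"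
  by (simp add: order_cone_def cone_def)

lemma cone_le_add:
  assumes "order_cone K" "cone_le K x y" "cone_le K x' y'"
  shows "cone_le K (x + x') (y + y')"
  using order_cone_add[OF assms(1), of "y - x" "y' - x'"] assms(2,3)
  by (simp add: cone_le_def algebra_simps)

lemma cone_le_scale:
  assumes "order_cone K" "cone_le K x y" "0 \<le> c"
  shows "cone_le K (c *\<^sub>R x) (c *\<^sub>R y)"
  using order_cone_scale[OF assms(1), of "y - x" c] assms(2,3)
  by (simp add: cone_le_def scaleR_diff_right)

lemma cone_le_trans:
  assumes "order_cone K" "cone_le K x y" "cone_le K y z"
  shows "cone_le K x z"
  using order_cone_add[OF assms(1), of "y - x" "z - y"] assms(2,3)
  by (simp add: cone_le_def)

lemma cone_le_scale_left:
  assumes "order_cone K" "x \<in> K" "c \<le> c'"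
  shows "cone_le K (c *\<^sub>R x) (c' *\<^sub>R x)"
  using order_cone_scale[OF assms(1,2), of "c' - c"] assms(3)
  by (simp add: cone_le_def scaleR_diff_left)

lemma cone_le_scale_inverse_iff:
  assumes "order_cone K" "0 < c"
  shows "cone_le K (inverse c *\<^sub>R x) y \<longleftrightarrow> cone_le K x (c *\<^sub>R y)"
  using cone_le_scale[OF assms(1), of "inverse c *\<^sub>R x" y c]
    cone_le_scale[OF assms(1), of x "c *\<^sub>R y" "inverse c"] assms(2)
  by auto

lemma mutual_bound_mono:
  assumes "order_cone K" "x \<in> K" "y \<in> K" "mutual_bound K c x y" "c \<le> c'"
  shows "mutual_bound K c' x y"
  using assms cone_le_trans[OF assms(1)] cone_le_scale_left[OF assms(1)]
  unfolding mutual_bound_def by blast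

section \<open>The Thompson metric in terms of mutual bounds\<close>

lemma thompson_eq_Inf_mutual_bound:
  assumes "order_cone K"
  shows "thompson K x y = Inf {ereal s | s. 0 \<le> s \<and> mutual_bound K (exp s) x y}"
  using cone_le_scale_inverse_iff[OF assms exp_gt_zero]
  by (simp add: thompson_def mutual_bound_def exp_minus)

lemma thompson_commute: "order_cone K \<Longrightarrow> thompson K x y = thompson K y x"
  by (simp add: thompson_eq_Inf_mutual_bound mutual_bound_commute)

lemma thompson_nonneg: "0 \<le> thompson K x y"
  unfolding thompson_def by (rule Inf_greatest) auto

lemma thompson_cases:
  obtains d where "thompson K x y = ereal d" "0 \<le> d" | "thompson K x y = \<infinity>"
  using thompson_nonneg[of K x y] by (cases "thompson K x y") auto

lemma thompson_le_ln:
  assumes "order_cone K" "1 \<le> c" "mutual_bound K c x y"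
  shows "thompson K x y \<le> ereal (ln c)"
  unfolding thompson_eq_Inf_mutual_bound[OF assms(1)]
  using assms(2,3) by (intro Inf_lower) auto

text \<open>The logarithm turns the slack factor \<open>exp e\<close> into a summand
  \<open>e\<close>, which can be made arbitrarily small. Thus \<open>c\<close> itself need not be an
  admissible constant.\<close>

lemma thompson_le_ln_limit:
  assumes "order_cone K" "1 \<le> c"
    and "\<And>e. 0 < e \<Longrightarrow> mutual_bound K (exp e * c) x y"
  shows "thompson K x y \<le> ereal (ln c)"
proof (rule ereal_le_epsilon2)
  fix e :: real
  assume e: "0 < e"
  have "1 * 1 \<le> exp e * c"
    using e assms(2) by (intro mult_mono) auto
  then have "thompson K x y \<le> ereal (ln (exp e * c))"
    using assms(3)[OF e] by (intro thompson_le_ln assms(1)) auto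
  also have "ln (exp e * c) = ln c + e"
    using assms(2) by (simp add: ln_mult)
  finally show "thompson K x y \<le> ereal (ln c) + ereal e"
    by simp
qed

text \<open>Some admissible exponent lies below \<open>e + d\<close>, as this number exceeds the
  infimum; enlarging a constant keeps it admissible.\<close>

lemma mutual_bound_of_thompson:
  assumes "order_cone K" "x \<in> K" "y \<in> K" "thompson K x y = ereal d" "0 < e"
  shows "mutual_bound K (exp e * exp d) x y"
proof -
  have "thompson K x y < ereal (e + d)"
    using assms by simp
  then obtain r where "r < e + d" "mutual_bound K (exp r) x y"
    unfolding thompson_eq_Inf_mutual_bound[OF assms(1)] Inf_less_iff by auto
  then have "mutual_bound K (exp (e + d)) x y"
    using mutual_bound_mono[OF assms(1-3)] by simp
  then show ?thesis
    by (simp add: exp_add)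
qed

lemma linked_imp_thompson_finite:
  assumes "order_cone K" "x \<in> K" "y \<in> K" "linked K x y"
  shows "thompson K x y \<noteq> \<infinity>"
proof -
  obtain l m where "cone_le K x (l *\<^sub>R y)" "cone_le K y (m *\<^sub>R x)"
    using assms(4) unfolding linked_def by blast
  \<comment> \<open>The maximum serves both inequalities at once; including \<open>1\<close> gives
    \<open>ln c \<ge> 0\<close>, as the infimum only ranges over nonnegative exponents.\<close>
  moreover define c where "c = max 1 (max l m)"
  ultimately have "mutual_bound K c x y"
    unfolding mutual_bound_def
    by (meson assms cone_le_scale_left cone_le_trans max.cobounded1 max.cobounded2
        order.trans)
  then have "thompson K x y \<le> ereal (ln c)"
    by (intro thompson_le_ln assms(1)) (simp_all add: c_def)
  then show ?thesis
    by auto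
qed

section \<open>Admissible constants for convex combinations and along a segment\<close>

lemma weighted_harmonic_le_arithmetic:
  fixes a b t :: real
  assumes "0 < a" "0 < b" "0 \<le> t" "t \<le> 1"
  shows "1 \<le> ((1 - t) * a + t * b) * ((1 - t) / a + t / b)"
proof -
  \<comment> \<open>The weights sum to \<open>1\<close>, so expanding the product leaves only a
    multiple of a square above \<open>1\<close>.\<close>
  have "((1 - t) * a + t * b) * ((1 - t) / a + t / b) - 1 = t * (1 - t) * (a - b)\<^sup>2 / (a * b)"
    using assms(1,2) by (simp add: field_simps power2_eq_square)
  also have "\<dots> \<ge> 0"
    using assms by simp
  finally show ?thesis
    by simp
qed

lemma mutual_bound_convex:
  assumes K: "order_cone K" "v \<in> K" and t: "0 \<le> t" "t \<le> 1" and ab: "0 < a" "0 < b"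
    and x: "mutual_bound K a x v" and y: "mutual_bound K b y v"
  shows "mutual_bound K ((1 - t) * a + t * b) ((1 - t) *\<^sub>R x + t *\<^sub>R y) v"
proof -
  let ?z = "(1 - t) *\<^sub>R x + t *\<^sub>R y" and ?c = "(1 - t) * a + t * b"
  let ?h = "(1 - t) / a + t / b"
  have "0 \<le> ?c"
    using t ab by simp
  have "cone_le K ?z ((1 - t) *\<^sub>R a *\<^sub>R v + t *\<^sub>R b *\<^sub>R v)"
    using x y t by (intro cone_le_add cone_le_scale K(1)) (auto simp: mutual_bound_def)
  then have upper: "cone_le K ?z (?c *\<^sub>R v)"
    by (simp add: scaleR_add_left)
  \<comment> \<open>Adding the lower bounds produces the factor \<open>?h\<close>, the weighted mean
    of the inverses, in place of the inverse of \<open>?c\<close>. Since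
    \<open>?c * ?h \<ge> 1\<close> and \<open>v\<close> lies in the cone, the required bound
    follows.\<close>
  have "cone_le K (inverse a *\<^sub>R v) x" "cone_le K (inverse b *\<^sub>R v) y"
    using x y ab K(1) by (auto simp: mutual_bound_def cone_le_scale_inverse_iff)
  then have "cone_le K ((1 - t) *\<^sub>R inverse a *\<^sub>R v + t *\<^sub>R inverse b *\<^sub>R v) ?z"
    using t by (intro cone_le_add cone_le_scale K(1)) auto
  then have "cone_le K (?h *\<^sub>R v) ?z"
    by (simp add: scaleR_add_left divide_inverse)
  from cone_le_scale[OF K(1) this \<open>0 \<le> ?c\<close>]
  have "cone_le K ((?c * ?h) *\<^sub>R v) (?c *\<^sub>R ?z)"
    by (simp only: scaleR_scaleR)
  moreover have "cone_le K (1 *\<^sub>R v) ((?c * ?h) *\<^sub>R v)"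
    using weighted_harmonic_le_arithmetic[OF ab t] by (intro cone_le_scale_left K)
  ultimately have "cone_le K v (?c *\<^sub>R ?z)"
    using cone_le_trans[OF K(1)] by simp
  with upper show ?thesis
    by (simp add: mutual_bound_def)
qed

text \<open>The right side minus the left side is \<open>t - s\<close> times the combination, with
  weights \<open>1 - s\<close> and \<open>s\<close>, of \<open>a x - y\<close> and
  \<open>a y - 2 y + x\<close>. Both of these lie in the cone.\<close>

lemma cone_le_segment:
  assumes K: "order_cone K" "y \<in> K" and st: "0 \<le> s" "s \<le> t" "t \<le> 1" and "0 < a"
    and xy: "mutual_bound K a x y"
  shows "cone_le K ((1 - t) *\<^sub>R x + t *\<^sub>R y)
    (((t - s) * a + 1 - (t - s)) *\<^sub>R ((1 - s) *\<^sub>R x + s *\<^sub>R y))"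
proof -
  \<comment> \<open>The vector \<open>a y - 2 y + x\<close> is split as
    \<open>(a - 2 + 1 / a) y\<close> plus \<open>x - y / a\<close>, and each summand lies in the
    cone.\<close>
  have "2 \<le> a + inverse a"
    using \<open>0 < a\<close> sum_squares_bound[of a 1] by (simp add: field_simps power2_eq_square)
  then have "(a - 2 + inverse a) *\<^sub>R y \<in> K"
    using K by (intro order_cone_scale) auto
  moreover have "cone_le K (inverse a *\<^sub>R y) x"
    using xy K(1) \<open>0 < a\<close> by (simp add: mutual_bound_def cone_le_scale_inverse_iff)
  ultimately have "(a - 2 + inverse a) *\<^sub>R y + (x - inverse a *\<^sub>R y) \<in> K"
    using K(1) by (intro order_cone_add) (auto simp: cone_le_def)
  then have "a *\<^sub>R y - y - y + x \<in> K"
    by (simp add: algebra_simps scaleR_2)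
  moreover have "a *\<^sub>R x - y \<in> K"
    using xy by (simp add: mutual_bound_def cone_le_def)
  ultimately have
    "(t - s) *\<^sub>R ((1 - s) *\<^sub>R (a *\<^sub>R x - y) + s *\<^sub>R (a *\<^sub>R y - y - y + x)) \<in> K"
    using st by (intro order_cone_scale[OF K(1) order_cone_add[OF K(1)
          order_cone_scale[OF K(1)] order_cone_scale[OF K(1)]]]) simp_all
  also have "(t - s) *\<^sub>R ((1 - s) *\<^sub>R (a *\<^sub>R x - y) + s *\<^sub>R (a *\<^sub>R y - y - y + x)) =
      ((t - s) * a + 1 - (t - s)) *\<^sub>R ((1 - s) *\<^sub>R x + s *\<^sub>R y)
        - ((1 - t) *\<^sub>R x + t *\<^sub>R y)"
    by (simp add: algebra_simps)
  finally show ?thesis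
    by (simp add: cone_le_def)
qed

lemma mutual_bound_segment:
  assumes K: "order_cone K" "x \<in> K" "y \<in> K"
    and "s \<in> {0..1}" "t \<in> {0..1}" "0 < a" "mutual_bound K a x y"
  shows "mutual_bound K (\<bar>s - t\<bar> * a + 1 - \<bar>s - t\<bar>)
    ((1 - t) *\<^sub>R x + t *\<^sub>R y) ((1 - s) *\<^sub>R x + s *\<^sub>R y)"
proof -
  have le: "mutual_bound K (\<bar>s - t\<bar> * a + 1 - \<bar>s - t\<bar>)
      ((1 - t) *\<^sub>R x + t *\<^sub>R y) ((1 - s) *\<^sub>R x + s *\<^sub>R y)"
    if "0 \<le> s" "s \<le> t" "t \<le> 1" for s t
    \<comment> \<open>The second inequality is the first one for the reversed segment: swapping
      \<open>x\<close> and \<open>y\<close> replaces the parameters \<open>s \<le> t\<close> by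
      \<open>1 - t \<le> 1 - s\<close>.\<close>
    using cone_le_segment[OF K(1,3) that assms(6,7)]
      cone_le_segment[OF K(1,2), of "1 - t" "1 - s" a y] that assms(6,7)
    by (simp add: mutual_bound_def add.commute)
  show ?thesis
  proof (cases "s \<le> t")
    case True
    then show ?thesis
      using le assms by simp
  next
    case False
    then show ?thesis
      using le[of t s] assms by (simp add: mutual_bound_commute abs_minus_commute)
  qed
qed

section \<open>From admissible constants to inequalities for the metric\<close>

lemma one_le_convex_combination:
  fixes a b t :: real
  assumes "0 \<le> t" "t \<le> 1" "1 \<le> a" "1 \<le> b"
  shows "1 \<le> (1 - t) * a + t * b"
  using convex_bound_le[of "- a" "-1" "- b" "1 - t" t] assms by simp

lemma ln_exp_ereal: "ln_ereal (exp_ereal x) = x"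
  by (cases x) (auto simp: exp_ereal_def ln_ereal_def zero_ereal_def)

lemma exp_ereal_infinity: "exp_ereal \<infinity> = \<infinity>"
  by (simp add: exp_ereal_def)

lemma exp_ereal_nonneg: "0 \<le> exp_ereal x"
  by (cases x) (auto simp: exp_ereal_def)

lemma thompson_convex_left:
  assumes K: "order_cone K" "x \<in> K" "y \<in> K" "v \<in> K" and t: "0 \<le> t" "t \<le> 1"
  shows "thompson K ((1 - t) *\<^sub>R x + t *\<^sub>R y) v
    \<le> ln_ereal (ereal (1 - t) * exp_ereal (thompson K x v)
        + ereal t * exp_ereal (thompson K y v))"
proof -
  \<comment> \<open>At the endpoints \<open>0 * \<infinity> = 0\<close> removes one term even if its
    distance is infinite, and the right side reduces to the other distance by
    \<open>ln_exp_ereal\<close>. For positive weights an infinite distance makes the right side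
    infinite.\<close>
  consider "t = 0" | "t = 1" | "0 < t" "t < 1"
    using t by linarith
  then show ?thesis
  proof cases
    case 3
    show ?thesis
    proof (cases "thompson K x v = \<infinity> \<or> thompson K y v = \<infinity>")
      case True
      then have "ereal (1 - t) * exp_ereal (thompson K x v)
          + ereal t * exp_ereal (thompson K y v) = \<infinity>"
        using 3 exp_ereal_nonneg[of "thompson K x v"] exp_ereal_nonneg[of "thompson K y v"]
        by (auto simp: exp_ereal_infinity)
      then show ?thesis
        by (simp only: ln_ereal_def) simp
    next
      case False
      then obtain a b where a: "thompson K x v = ereal a" "0 \<le> a"
        and b: "thompson K y v = ereal b" "0 \<le> b"
        by (metis thompson_cases)
      let ?c = "(1 - t) * exp a + t * exp b"
      have c: "1 \<le> ?c"
        using t a b by (intro one_le_convex_combination) auto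
      have "thompson K ((1 - t) *\<^sub>R x + t *\<^sub>R y) v \<le> ereal (ln ?c)"
      proof (rule thompson_le_ln_limit[OF K(1) c])
        fix e :: real
        assume "0 < e"
        \<comment> \<open>The combined constant is homogeneous in the two given ones, so their
          common slack \<open>exp e\<close> factors out.\<close>
        then have "mutual_bound K ((1 - t) * (exp e * exp a) + t * (exp e * exp b))
            ((1 - t) *\<^sub>R x + t *\<^sub>R y) v"
          using a b K t by (intro mutual_bound_convex mutual_bound_of_thompson) auto
        then show "mutual_bound K (exp e * ?c) ((1 - t) *\<^sub>R x + t *\<^sub>R y) v"
          by (simp add: algebra_simps)
      qed
      then show ?thesis
        using a b c by (simp add: exp_ereal_def ln_ereal_def)
    qed
  qed (simp_all add: ln_exp_ereal flip: zero_ereal_def one_ereal_def)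
qed

text \<open>For finite distances this follows from \<open>thompson_convex_left\<close>, because a
  weighted mean of \<open>exp a\<close> and \<open>exp b\<close> is at most
  \<open>exp (max a b)\<close>.\<close>

lemma thompson_quasiconvex_left:
  assumes K: "order_cone K" "x \<in> K" "y \<in> K" "v \<in> K" and t: "0 \<le> t" "t \<le> 1"
  shows "thompson K ((1 - t) *\<^sub>R x + t *\<^sub>R y) v \<le> max (thompson K x v) (thompson K y v)"
proof (cases "thompson K x v = \<infinity> \<or> thompson K y v = \<infinity>")
  case False
  then obtain a b where a: "thompson K x v = ereal a" "0 \<le> a"
    and b: "thompson K y v = ereal b" "0 \<le> b"
    by (metis thompson_cases)
  let ?c = "(1 - t) * exp a + t * exp b"
  have c: "1 \<le> ?c"
    using t a b by (intro one_le_convex_combination) auto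
  have "?c \<le> exp (max a b)"
    using t by (intro convex_bound_le) auto
  then have "ln ?c \<le> max a b"
    using c by (subst exp_le_cancel_iff[symmetric]) simp
  then have "ereal (ln ?c) \<le> max (thompson K x v) (thompson K y v)"
    using a b by (simp add: le_max_iff_disj)
  moreover have "thompson K ((1 - t) *\<^sub>R x + t *\<^sub>R y) v \<le> ereal (ln ?c)"
    using thompson_convex_left[OF assms] a b c by (simp add: exp_ereal_def ln_ereal_def)
  ultimately show ?thesis
    by (rule order_trans[rotated])
qed auto

lemma thompson_segment:
  assumes K: "order_cone K" "x \<in> K" "y \<in> K" and st: "s \<in> {0..1}" "t \<in> {0..1}"
    and "linked K x y"
  shows "thompson K ((1 - t) *\<^sub>R x + t *\<^sub>R y) ((1 - s) *\<^sub>R x + s *\<^sub>R y)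
    \<le> ln_ereal (ereal \<bar>s - t\<bar> * exp_ereal (thompson K x y) + 1 - ereal \<bar>s - t\<bar>)"
proof -
  let ?p = "(1 - t) *\<^sub>R x + t *\<^sub>R y" and ?q = "(1 - s) *\<^sub>R x + s *\<^sub>R y"
  define D where "D = \<bar>s - t\<bar>"
  have D: "0 \<le> D" "D \<le> 1"
    using st by (auto simp: D_def)
  obtain d where d: "thompson K x y = ereal d" "0 \<le> d"
    using linked_imp_thompson_finite[OF K \<open>linked K x y\<close>] by (metis thompson_cases)
  let ?c = "D * exp d + 1 - D"
  have c: "1 \<le> ?c"
    using one_le_convex_combination[of D 1 "exp d"] D d by simp
  have pq: "?p \<in> K" "?q \<in> K"
    using K st by (auto intro!: order_cone_add order_cone_scale)
  have "thompson K ?p ?q \<le> ereal (ln ?c)"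
  proof (rule thompson_le_ln_limit[OF K(1) c])
    fix e :: real
    assume e: "0 < e"
    then have "mutual_bound K (D * (exp e * exp d) + 1 - D) ?p ?q"
      unfolding D_def using K st d by (intro mutual_bound_segment mutual_bound_of_thompson) auto
    \<comment> \<open>Here the constant is only affine in \<open>exp d\<close>, so the slack does
      not factor out; multiplying the remaining term \<open>1 - D\<close> by \<open>exp e\<close> as
      well only enlarges the constant.\<close>
    moreover have "(1 - D) * 1 \<le> (1 - D) * exp e"
      using D e by (intro mult_left_mono) auto
    then have "D * (exp e * exp d) + 1 - D \<le> exp e * ?c"
      by (simp add: algebra_simps)
    ultimately show "mutual_bound K (exp e * ?c) ?p ?q"
      using mutual_bound_mono[OF K(1) pq] by blast
  qed
  then show ?thesis
    using d c by (simp add: exp_ereal_def ln_ereal_def one_ereal_def flip: D_def)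
qed

theorem theorem3p11:
  fixes K :: "'a::real_vector set"
  assumes "order_cone K"
  shows
    "(\<forall>x\<in>K. \<forall>y\<in>K. \<forall>u\<in>K. \<forall>v\<in>K. \<forall>t\<in>{0..1::real}.
        thompson K ((1 - t) *\<^sub>R x + t *\<^sub>R y) v
          \<le> max (thompson K x v) (thompson K y v) \<and>
        thompson K u ((1 - t) *\<^sub>R x + t *\<^sub>R y)
          \<le> max (thompson K u x) (thompson K u y)) \<and>
     (\<forall>x\<in>K. \<forall>y\<in>K. \<forall>u\<in>K. \<forall>v\<in>K. \<forall>t\<in>{0..1::real}.
        thompson K ((1 - t) *\<^sub>R x + t *\<^sub>R y) v
          \<le> ln_ereal (ereal (1 - t) * exp_ereal (thompson K x v)
                      + ereal t * exp_ereal (thompson K y v)) \<and>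
        thompson K u ((1 - t) *\<^sub>R x + t *\<^sub>R y)
          \<le> ln_ereal (ereal (1 - t) * exp_ereal (thompson K u x)
                      + ereal t * exp_ereal (thompson K u y))) \<and>
     (\<forall>x\<in>K. \<forall>y\<in>K. \<forall>s\<in>{0..1::real}. \<forall>t\<in>{0..1::real}.
        linked K x y \<longrightarrow>
        thompson K ((1 - t) *\<^sub>R x + t *\<^sub>R y) ((1 - s) *\<^sub>R x + s *\<^sub>R y)
          \<le> ln_ereal (ereal \<bar>s - t\<bar> * exp_ereal (thompson K x y) + 1 - ereal \<bar>s - t\<bar>))"
proof (intro conjI ballI impI)
  fix x y u t
  assume "x \<in> K" "y \<in> K" "u \<in> K" "t \<in> {0..1::real}"
  then show
    "thompson K u ((1 - t) *\<^sub>R x + t *\<^sub>R y) \<le> max (thompson K u x) (thompson K u y)"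
    "thompson K u ((1 - t) *\<^sub>R x + t *\<^sub>R y)
      \<le> ln_ereal (ereal (1 - t) * exp_ereal (thompson K u x)
          + ereal t * exp_ereal (thompson K u y))"
    \<comment> \<open>Symmetry of the metric moves \<open>u\<close> into the second argument, where
      the inequalities already proved apply.\<close>
    using thompson_quasiconvex_left[OF assms, of x y u t] thompson_convex_left[OF assms, of x y u t]
    by (simp_all add: thompson_commute[OF assms, of u])
qed (use assms in \<open>auto intro: thompson_quasiconvex_left thompson_convex_left thompson_segment\<close>)

end
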